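(* For each $\alpha>0$ and $0<p,q\le\infty$, $$\sup_{\|f\|_{\mathcal F_\alpha^{p,q}}\le1}M_p(f,r)\ \asymp\ (1+r)^{-\frac1q}e^{\frac\alpha2r^2},\qquad r\ge0,$$ i.e. the two sides are bounded by constant multiples of each other for all $r\ge0$, where the implicit constants depend only on $\alpha$ and $q$ (and $\frac1\infty=0$).
   Context: For an entire function $f$ and $r\ge0$, $M_p(f,r):=\left(\frac1{2\pi}\int_0^{2\pi}|f(re^{i\theta})|^p\,d\theta\right)^{1/p}$ for $0<p<\infty$, and $M_\infty(f,r):=\sup_{\theta\in[0,2\pi]}|f(re^{i\theta})|$. Put $$\|f\|_{\mathcal F_\alpha^{p,q}}:=\left(\int_0^\infty M_p(f,r)^q\,\alpha q\,e^{-\frac{\alpha q}{2}r^2}r\,dr\right)^{1/q}\ (0<q<\infty),\qquad \|f\|_{\mathcal F_\alpha^{p,\infty}}:=\sup_{r\ge0}M_p(f,r)e^{-\frac{\alpha}{2}r^2}.$$ $\mathcal F_\alpha^{p,q}$ is the set of entire functions with finite (quasi-)norm; the supremum is over $f\in\mathcal F_\alpha^{p,q}$. *)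

theory Defs
  imports "HOL-Complex_Analysis.Complex_Analysis"
begin

text \<open>
  All means, norms and suprema take values in \<^typ>\<open>ennreal\<close>, so that an infinite integral or an
  unbounded supremum really is \<^term>\<open>\<infinity> :: ennreal\<close>. Exponents \<open>p, q\<close> in \<open>(0, \<infinity>]\<close> are also
  elements of \<^typ>\<open>ennreal\<close>.
\<close>

text \<open>Real powers on \<open>[0, \<infinity>]\<close>, meant for exponents \<open>s > 0\<close> only: then \<open>0\<close> and \<open>\<infinity>\<close> are fixed.\<close>

definition ennpowr :: "ennreal \<Rightarrow> real \<Rightarrow> ennreal" where
  "ennpowr x s = (if x = \<infinity> then \<infinity> else ennreal (enn2real x powr s))"

definition integral_mean :: "ennreal \<Rightarrow> (complex \<Rightarrow> complex) \<Rightarrow> real \<Rightarrow> ennreal" where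
  "integral_mean p f r =
     (if p = \<infinity>
      then (SUP \<theta>\<in>{0..2 * pi}. ennreal (cmod (f (of_real r * exp (\<i> * of_real \<theta>)))))
      else ennpowr
             (ennreal (1 / (2 * pi)) *
              (\<integral>\<^sup>+\<theta>\<in>{0..2 * pi}.
                 ennreal (cmod (f (of_real r * exp (\<i> * of_real \<theta>))) powr enn2real p) \<partial>lborel))
             (1 / enn2real p))"

definition fock_norm :: "real \<Rightarrow> ennreal \<Rightarrow> ennreal \<Rightarrow> (complex \<Rightarrow> complex) \<Rightarrow> ennreal" where
  "fock_norm \<alpha> p q f =
     (if q = \<infinity>
      then (SUP r\<in>{0..}. integral_mean p f r * ennreal (exp (- (\<alpha> / 2) * r\<^sup>2)))
      else ennpowr
             (\<integral>\<^sup>+r\<in>{0..}.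
                ennpowr (integral_mean p f r) (enn2real q) *
                ennreal (\<alpha> * enn2real q * exp (- (\<alpha> * enn2real q / 2) * r\<^sup>2) * r) \<partial>lborel)
             (1 / enn2real q))"

definition fock_space :: "real \<Rightarrow> ennreal \<Rightarrow> ennreal \<Rightarrow> (complex \<Rightarrow> complex) set" where
  "fock_space \<alpha> p q = {f. f holomorphic_on UNIV \<and> fock_norm \<alpha> p q f < \<infinity>}"

end

theory Submission
  imports Defs "HOL-Probability.Distributions"
begin

text \<open>
  Write \<open>M \<rho>\<close> for \<open>M\<^sub>p(f, \<rho>)\<close>. By Hardy's theorem, \<open>\<rho> powr s * M \<rho>\<close> obeys the
  maximum principle for every real \<open>s\<close>, whatever \<open>p\<close> is. With \<open>s = - \<alpha> * r\<^sup>2\<close> this bounds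
  \<open>M \<rho> * exp (- \<alpha> / 2 * \<rho>\<^sup>2)\<close> from below by a constant multiple of its value at \<open>r\<close> on a whole
  interval of length \<open>1 / 2\<close> ending or starting at \<open>r\<close>; integrating against \<open>\<rho> d\<rho>\<close> gives the
  factor \<open>1 + r\<close> of the upper bound. The lower bound is attained by multiples of \<open>z ^ n\<close> with
  \<open>n = \<lfloor>\<alpha> * r\<^sup>2\<rfloor>\<close>, whose means do not depend on \<open>p\<close>.
\<close>

subsection \<open>A maximum principle for locally supported functions\<close>

text \<open>This stands in for subharmonicity: it passes to finite sums and products, holds for
  \<open>\<lambda>z. cmod (g z) powr s\<close> with holomorphic \<open>g\<close>, and yields a maximum principle.\<close>

definition modulus_supported :: "(complex \<Rightarrow> real) \<Rightarrow> complex \<Rightarrow> bool" where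
  "modulus_supported u w \<longleftrightarrow>
     (\<exists>S h. open S \<and> w \<in> S \<and> h holomorphic_on S \<and> h w = of_real (u w) \<and> (\<forall>z\<in>S. cmod (h z) \<le> u z))"

lemma modulus_supportedE:
  assumes "modulus_supported u w"
  obtains S h where "open S" "w \<in> S" "h holomorphic_on S" "h w = of_real (u w)"
    "\<And>z. z \<in> S \<Longrightarrow> cmod (h z) \<le> u z"
  using assms unfolding modulus_supported_def by blast

lemma modulus_supported_const: "c \<ge> 0 \<Longrightarrow> modulus_supported (\<lambda>z. c) w"
  unfolding modulus_supported_def
  by (rule exI[of _ UNIV], rule exI[of _ "\<lambda>z. of_real c"]) auto

text \<open>The support prescribes \<open>h w\<close> itself and not only its modulus. Both values
  at \<open>w\<close> are therefore nonnegative reals, no cancellation occurs, and the sum of the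
  two supports still touches the sum of the functions at \<open>w\<close>.\<close>

lemma modulus_supported_add:
  assumes "modulus_supported u w" "modulus_supported v w"
  shows "modulus_supported (\<lambda>z. u z + v z) w"
proof -
  obtain S h where 1: "open S" "w \<in> S" "h holomorphic_on S" "h w = of_real (u w)"
    "\<And>z. z \<in> S \<Longrightarrow> cmod (h z) \<le> u z"
    using assms(1) by (elim modulus_supportedE) blast
  obtain T k where 2: "open T" "w \<in> T" "k holomorphic_on T" "k w = of_real (v w)"
    "\<And>z. z \<in> T \<Longrightarrow> cmod (k z) \<le> v z"
    using assms(2) by (elim modulus_supportedE) blast
  have "(\<lambda>z. h z + k z) holomorphic_on S \<inter> T"
    using 1(3) 2(3) by (intro holomorphic_intros) (auto elim: holomorphic_on_subset)
  moreover have "cmod (h z + k z) \<le> u z + v z" if "z \<in> S \<inter> T" for z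
    using 1(5)[of z] 2(5)[of z] that norm_triangle_ineq[of "h z" "k z"] by auto
  ultimately show ?thesis
    unfolding modulus_supported_def using 1 2
    by (intro exI[of _ "S \<inter> T"] exI[of _ "\<lambda>z. h z + k z"]) auto
qed

lemma modulus_supported_mult:
  assumes "modulus_supported u w" "modulus_supported v w"
  shows "modulus_supported (\<lambda>z. u z * v z) w"
proof -
  obtain S h where 1: "open S" "w \<in> S" "h holomorphic_on S" "h w = of_real (u w)"
    "\<And>z. z \<in> S \<Longrightarrow> cmod (h z) \<le> u z"
    using assms(1) by (elim modulus_supportedE) blast
  obtain T k where 2: "open T" "w \<in> T" "k holomorphic_on T" "k w = of_real (v w)"
    "\<And>z. z \<in> T \<Longrightarrow> cmod (k z) \<le> v z"
    using assms(2) by (elim modulus_supportedE) blast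
  have "(\<lambda>z. h z * k z) holomorphic_on S \<inter> T"
    using 1(3) 2(3) by (intro holomorphic_intros) (auto elim: holomorphic_on_subset)
  moreover have "cmod (h z * k z) \<le> u z * v z" if "z \<in> S \<inter> T" for z
  proof -
    have "cmod (h z) \<le> u z" "cmod (k z) \<le> v z"
      using 1(5) 2(5) that by auto
    then show ?thesis
      using order_trans[OF norm_ge_zero, of "h z" "u z"] by (simp add: norm_mult mult_mono)
  qed
  ultimately show ?thesis
    unfolding modulus_supported_def using 1 2
    by (intro exI[of _ "S \<inter> T"] exI[of _ "\<lambda>z. h z * k z"]) auto
qed

lemma modulus_supported_sum:
  assumes "\<And>i. i \<in> I \<Longrightarrow> modulus_supported (u i) w"
  shows "modulus_supported (\<lambda>z. \<Sum>i\<in>I. u i z) w"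
  using assms by (induction I rule: infinite_finite_induct)
    (auto intro: modulus_supported_const modulus_supported_add)

text \<open>The support is a local branch of \<open>g\<close> to the power \<open>s\<close>, rotated
  to be a nonnegative real at \<open>w\<close>. Dividing by \<open>g w\<close> puts the base point
  at 1, away from the cut of \<open>Ln\<close>, and \<open>S\<close> is where the quotient avoids
  that cut. As \<open>g w\<close> is nonzero, \<open>s\<close> may be negative.\<close>

lemma modulus_supported_norm_powr:
  assumes "open T" "w \<in> T" "g holomorphic_on T" "g w \<noteq> 0"
  shows "modulus_supported (\<lambda>z. cmod (g z) powr s) w"
proof -
  define S where "S = {z \<in> T. g z / g w \<in> - \<real>\<^sub>\<le>\<^sub>0}"
  define h where "h z = of_real (cmod (g w) powr s) * exp (of_real s * Ln (g z / g w))" for z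
  have "continuous_on T (\<lambda>z. g z / g w)"
    using assms by (intro continuous_intros holomorphic_on_imp_continuous_on) auto
  moreover have "open (- (\<real>\<^sub>\<le>\<^sub>0 :: complex set))"
    by (simp add: open_Compl)
  ultimately have "open S"
    using continuous_open_preimage[of T "\<lambda>z. g z / g w" "- \<real>\<^sub>\<le>\<^sub>0"] assms(1)
    by (simp add: S_def Int_def vimage_def)
  moreover have "w \<in> S"
    using assms by (auto simp: S_def)
  moreover have "h holomorphic_on S"
    unfolding h_def
    by (intro holomorphic_intros holomorphic_on_subset[OF assms(3)])
      (use assms in \<open>auto simp: S_def\<close>)
  moreover have "h w = of_real (cmod (g w) powr s)"
    using assms by (simp add: h_def)
  moreover have "cmod (h z) \<le> cmod (g z) powr s" if "z \<in> S" for z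
  proof -
    have nz: "g z \<noteq> 0"
      using that by (auto simp: S_def)
    have "exp (s * ln (cmod (g z) / cmod (g w))) = (cmod (g z) / cmod (g w)) powr s"
      using nz assms(4) by (simp add: powr_def)
    then have "cmod (h z) = cmod (g w) powr s * (cmod (g z) / cmod (g w)) powr s"
      using nz assms(4) by (simp add: h_def norm_mult norm_divide)
    also have "\<dots> = cmod (g z) powr s"
      using assms(4) by (simp add: powr_divide)
    finally show ?thesis by simp
  qed
  ultimately show ?thesis
    unfolding modulus_supported_def by (intro exI[of _ S] exI[of _ h]) auto
qed

lemma modulus_supported_norm_powr_pos:
  assumes "open T" "w \<in> T" "g holomorphic_on T" "s > 0"
  shows "modulus_supported (\<lambda>z. cmod (g z) powr s) w"
proof (cases "g w = 0")
  \<comment> \<open>At a zero of \<open>g\<close> the function has value 0, so the constant 0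
    touches it from below.\<close>
  case True
  then show ?thesis
    using assms unfolding modulus_supported_def
    by (intro exI[of _ T] exI[of _ "\<lambda>z. 0"]) auto
qed (use assms modulus_supported_norm_powr in blast)

lemma modulus_supported_norm:
  assumes "open T" "w \<in> T" "g holomorphic_on T"
  shows "modulus_supported (\<lambda>z. cmod (g z)) w"
  using modulus_supported_norm_powr_pos[OF assms, of 1] by simp

text \<open>At a maximum point of largest modulus the supporting function is constant near that point,
  which forces \<open>u\<close> to be maximal at points of larger modulus. For \<open>a < 0\<close> the annulus is a disc.\<close>

lemma modulus_supported_max_principle:
  fixes a b :: real
  assumes cont: "continuous_on {z. a \<le> cmod z \<and> cmod z \<le> b} u"
    and supp: "\<And>w. a < cmod w \<Longrightarrow> cmod w < b \<Longrightarrow> modulus_supported u w"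
    and bd: "\<And>z. cmod z = a \<or> cmod z = b \<Longrightarrow> u z \<le> B"
    and z: "a \<le> cmod z" "cmod z \<le> b"
  shows "u z \<le> B"
proof (rule ccontr)
  assume "\<not> u z \<le> B"
  define A where "A = {z :: complex. a \<le> cmod z \<and> cmod z \<le> b}"
  have "closed A"
    unfolding A_def by (intro closed_Collect_conj closed_Collect_le continuous_intros)
  moreover have "bounded A"
    by (rule bounded_subset[OF bounded_cball[of 0 b]]) (auto simp: A_def)
  ultimately have "compact A"
    by (simp add: compact_eq_bounded_closed)
  have "z \<in> A"
    using z by (simp add: A_def)
  obtain y where y: "y \<in> A" "\<And>x. x \<in> A \<Longrightarrow> u x \<le> u y"
    using continuous_attains_sup[OF \<open>compact A\<close>, of u] \<open>z \<in> A\<close> cont unfolding A_def by blast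
  define K where "K = {x \<in> A. u x = u y}"
  have "closed K"
  proof -
    have "K = A \<inter> u -` {u y}" by (auto simp: K_def)
    then show ?thesis
      using continuous_closed_preimage[OF _ \<open>closed A\<close>, of u "{u y}"] cont
      by (simp add: A_def)
  qed
  then have "compact K"
    using compact_Int_closed[OF \<open>compact A\<close>, of K] by (simp add: K_def Int_def)
  have "y \<in> K" using y by (simp add: K_def)
  obtain w where w: "w \<in> K" "\<And>x. x \<in> K \<Longrightarrow> cmod x \<le> cmod w"
    using continuous_attains_sup[OF \<open>compact K\<close>, of cmod] \<open>y \<in> K\<close>
    by (auto intro: continuous_intros)
  \<comment> \<open>The boundary values are at most \<open>B\<close>, so this excludes both boundary
    circles and makes \<open>w\<close> an interior point.\<close>
  have "u w > B"
    using w(1) y(2)[OF \<open>z \<in> A\<close>] \<open>\<not> u z \<le> B\<close> by (simp add: K_def)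
  then have ab: "a < cmod w" "cmod w < b"
    using w(1) bd[of w] by (force simp: K_def A_def)+
  obtain S h where h: "open S" "w \<in> S" "h holomorphic_on S" "h w = of_real (u w)"
    "\<And>z. z \<in> S \<Longrightarrow> cmod (h z) \<le> u z"
    using supp[OF ab] by (elim modulus_supportedE) blast
  have "open (S \<inter> {x. a < cmod x \<and> cmod x < b})"
    using h(1) by (intro open_Int open_Collect_conj open_Collect_less continuous_intros)
  then obtain e where e: "e > 0" "ball w e \<subseteq> S \<inter> {x. a < cmod x \<and> cmod x < b}"
    using h(2) ab by (auto elim: openE)
  have hw: "cmod (h w) = u w"
    using h(4) h(5)[OF h(2)] by simp
  have "h constant_on ball w e"
  proof (rule maximum_modulus_principle)
    show "h holomorphic_on ball w e"
      using h(3) e(2) by (auto elim: holomorphic_on_subset)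
    show "cmod (h x) \<le> cmod (h w)" if "x \<in> ball w e" for x
    proof -
      have "x \<in> S" "x \<in> A" using that e(2) by (auto simp: A_def less_imp_le)
      then show ?thesis
        using h(5)[of x] y(2)[of x] w(1) hw by (simp add: K_def)
    qed
  qed (use e(1) in auto)
  \<comment> \<open>A point of the ball lying radially further out than \<open>w\<close>. The origin
    needs its own direction, since \<open>sgn 0 = 0\<close>.\<close>
  define x where "x = w + of_real (e / 2) * (if w = 0 then 1 else sgn w)"
  have "x \<in> ball w e"
    using e(1) by (auto simp: x_def dist_norm norm_mult norm_sgn)
  have "cmod x > cmod w"
  proof (cases "w = 0")
    case False
    then have "x = of_real (cmod w + e / 2) * sgn w"
      by (simp add: x_def sgn_div_norm scaleR_conv_of_real field_simps)
    then show ?thesis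
      using False e(1) by (simp add: norm_mult norm_sgn del: of_real_add)
  qed (use e(1) in \<open>simp add: x_def\<close>)
  moreover have "x \<in> K"
  proof -
    have "h x = h w"
      using \<open>h constant_on ball w e\<close> \<open>x \<in> ball w e\<close> e(1) by (metis constant_on_def centre_in_ball)
    moreover have "x \<in> S" "x \<in> A"
      using \<open>x \<in> ball w e\<close> e(2) by (auto simp: A_def less_imp_le)
    ultimately show ?thesis
      using h(5)[of x] hw y(2)[of x] w(1) by (simp add: K_def)
  qed
  ultimately show False using w(2)[of x] by simp
qed

subsection \<open>Circular means\<close>

definition circle_mean :: "(complex \<Rightarrow> real) \<Rightarrow> real \<Rightarrow> real" where
  "circle_mean g \<rho> = integral {0..2 * pi} (\<lambda>\<theta>. g (of_real \<rho> * cis \<theta>)) / (2 * pi)"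

lemma integral_periodic_shift:
  fixes h :: "real \<Rightarrow> real"
  assumes cont: "continuous_on UNIV h" and per: "\<And>x. h (x + T) = h x"
    and \<phi>: "0 \<le> \<phi>" "\<phi> \<le> T"
  shows "integral {\<phi>..\<phi> + T} h = integral {0..T} h"
proof -
  have int: "h integrable_on {a..b}" for a b
    by (intro integrable_continuous_real continuous_on_subset[OF cont]) auto
  have "integral {\<phi>..\<phi> + T} h = integral {\<phi>..T} h + integral {T..\<phi> + T} h"
    using \<phi> int by (intro Henstock_Kurzweil_Integration.integral_combine[symmetric]) auto
  also have "integral {T..\<phi> + T} h = integral {0..\<phi>} h"
    using integral_shift[of 0 T \<phi> h] continuous_on_subset[OF cont] by (simp add: o_def per)
  also have "integral {\<phi>..T} h + integral {0..\<phi>} h = integral {0..T} h"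
    using Henstock_Kurzweil_Integration.integral_combine[of 0 \<phi> T h] \<phi> int by simp
  finally show ?thesis .
qed

text \<open>Induction on the number of cells: each new cell of length \<open>\<delta>\<close> adds
  an error of at most \<open>e * \<delta>\<close>, the oscillation bound times its length.\<close>

lemma Riemann_sum_error:
  fixes h :: "real \<Rightarrow> real" and \<phi> \<delta> e :: real and n :: nat
  assumes cont: "continuous_on UNIV h" and "\<delta> \<ge> 0"
    and e: "\<And>(k::nat) t. k < n \<Longrightarrow> t \<in> {\<phi> + k * \<delta>..\<phi> + (real k + 1) * \<delta>} \<Longrightarrow> \<bar>h t - h (\<phi> + k * \<delta>)\<bar> \<le> e"
  shows "\<bar>integral {\<phi>..\<phi> + n * \<delta>} h - \<delta> * (\<Sum>k<n. h (\<phi> + k * \<delta>))\<bar> \<le> e * (n * \<delta>)"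
  using e
proof (induction n)
  case (Suc n)
  have int: "h integrable_on {a..b}" for a b
    by (intro integrable_continuous_real continuous_on_subset[OF cont]) auto
  let ?a = "\<phi> + n * \<delta>"
  have split: "integral {\<phi>..\<phi> + Suc n * \<delta>} h = integral {\<phi>..?a} h + integral {?a..?a + \<delta>} h"
    using \<open>\<delta> \<ge> 0\<close> int
    by (subst Henstock_Kurzweil_Integration.integral_combine) (auto simp: algebra_simps)
  have "integral {?a..?a + \<delta>} (\<lambda>t. h t - h ?a) = integral {?a..?a + \<delta>} h - \<delta> * h ?a"
    using int \<open>\<delta> \<ge> 0\<close> by (subst integral_diff) auto
  moreover have "norm (integral {?a..?a + \<delta>} (\<lambda>t. h t - h ?a)) \<le> e * (?a + \<delta> - ?a)"
    using \<open>\<delta> \<ge> 0\<close> Suc.prems[of n]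
    by (intro integral_bound continuous_intros continuous_on_subset[OF cont])
      (auto simp: algebra_simps)
  ultimately have "\<bar>integral {?a..?a + \<delta>} h - \<delta> * h ?a\<bar> \<le> e * \<delta>"
    by simp
  moreover have "\<bar>integral {\<phi>..?a} h - \<delta> * (\<Sum>k<n. h (\<phi> + k * \<delta>))\<bar> \<le> e * (n * \<delta>)"
    using Suc.prems by (intro Suc.IH) auto
  ultimately show ?case
    unfolding split by (simp add: algebra_simps)
qed simp

text \<open>A single threshold for \<open>N\<close> serves every starting point \<open>z\<close> on
  the circle: the error depends only on the modulus of continuity, and by periodicity the integral
  over a full turn does not depend on where the turn begins.\<close>

lemma circle_Riemann_sum:
  assumes cont: "continuous_on UNIV g" and "e > 0"
  shows "\<forall>\<^sub>F N in sequentially. \<forall>z. cmod z = \<rho> \<longrightarrow>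
     \<bar>(\<Sum>k<N. g (z * cis (2 * pi * real k / real N))) / real N - circle_mean g \<rho>\<bar> \<le> e"
proof -
  define h where "h \<theta> = g (of_real \<rho> * cis \<theta>)" for \<theta>
  have h: "continuous_on S h" for S
    unfolding h_def by (intro continuous_intros continuous_on_compose2[OF cont]) auto
  \<comment> \<open>The starting angle lies in \<open>{0..2 * pi}\<close> and one full turn follows,
    so all nodes stay below \<open>4 * pi\<close>.\<close>
  have "uniformly_continuous_on {0..4 * pi} h"
    by (intro compact_uniformly_continuous h) auto
  then obtain d where d: "d > 0"
    "\<And>s t. s \<in> {0..4 * pi} \<Longrightarrow> t \<in> {0..4 * pi} \<Longrightarrow> \<bar>t - s\<bar> < d \<Longrightarrow> \<bar>h t - h s\<bar> < e"
    using \<open>e > 0\<close> unfolding uniformly_continuous_on_def dist_real_def by metis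
  have "\<forall>\<^sub>F N in sequentially. 2 * pi / real N < d"
    using d(1) by real_asymp
  moreover have "\<forall>\<^sub>F N in sequentially. N > 0"
    by (rule eventually_gt_at_top)
  ultimately show ?thesis
  proof eventually_elim
    case (elim N)
    define \<delta> where "\<delta> = 2 * pi / real N"
    have N\<delta>: "real N * \<delta> = 2 * pi" and \<delta>: "0 < \<delta>" "\<delta> < d"
      using elim by (simp_all add: \<delta>_def)
    show ?case
    proof (intro allI impI)
      fix z :: complex
      assume "cmod z = \<rho>"
      define \<phi> where "\<phi> = Arg2pi z"
      have \<phi>: "0 \<le> \<phi>" "\<phi> \<le> 2 * pi" and z: "z = of_real \<rho> * cis \<phi>"
        using Arg2pi[of z] \<open>cmod z = \<rho>\<close> by (auto simp: \<phi>_def cis_conv_exp is_Arg_def)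
      have sum: "(\<Sum>k<N. g (z * cis (2 * pi * real k / real N))) = (\<Sum>k<N. h (\<phi> + k * \<delta>))"
        by (simp add: h_def z \<delta>_def mult_ac flip: cis_mult)
      have "\<bar>integral {\<phi>..\<phi> + N * \<delta>} h - \<delta> * (\<Sum>k<N. h (\<phi> + k * \<delta>))\<bar> \<le> e * (N * \<delta>)"
      proof (rule Riemann_sum_error[OF h])
        fix k t
        assume k: "k < N" and t: "t \<in> {\<phi> + real k * \<delta>..\<phi> + (real k + 1) * \<delta>}"
        have "(real k + 1) * \<delta> \<le> real N * \<delta>"
          using k \<delta> by (intro mult_right_mono) auto
        moreover have "0 \<le> real k * \<delta>" using \<delta> by simp
        ultimately have "t \<in> {0..4 * pi}" "\<phi> + k * \<delta> \<in> {0..4 * pi}" "\<bar>t - (\<phi> + k * \<delta>)\<bar> < d"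
          using t \<phi> \<delta> N\<delta> unfolding atLeastAtMost_iff by (linarith | simp add: algebra_simps)+
        then show "\<bar>h t - h (\<phi> + k * \<delta>)\<bar> \<le> e"
          using d(2) by (intro less_imp_le) auto
      qed (use \<delta> in simp)
      moreover have "integral {\<phi>..\<phi> + N * \<delta>} h = 2 * pi * circle_mean g \<rho>"
      proof -
        have "integral {\<phi>..\<phi> + 2 * pi} h = integral {0..2 * pi} h"
          using \<phi> by (intro integral_periodic_shift h) (auto simp: h_def cis.code)
        then show ?thesis
          by (simp add: N\<delta> circle_mean_def h_def[abs_def])
      qed
      ultimately have "\<bar>2 * pi * circle_mean g \<rho> - 2 * pi / N * (\<Sum>k<N. h (\<phi> + k * \<delta>))\<bar> \<le> e * (2 * pi)"
        by (simp add: N\<delta>) (simp add: \<delta>_def)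
      also have "2 * pi * circle_mean g \<rho> - 2 * pi / N * (\<Sum>k<N. h (\<phi> + k * \<delta>)) =
          - (2 * pi * ((\<Sum>k<N. h (\<phi> + k * \<delta>)) / N - circle_mean g \<rho>))"
        by (simp add: algebra_simps)
      finally show "\<bar>(\<Sum>k<N. g (z * cis (2 * pi * real k / real N))) / real N - circle_mean g \<rho>\<bar> \<le> e"
        unfolding sum by (simp add: abs_mult)
    qed
  qed
qed

text \<open>Riemann sums keep the number of summands finite, so that the supporting functions of the
  rotates share a common domain.\<close>

lemma circle_mean_max_principle:
  fixes a b r :: real
  assumes g: "continuous_on UNIV g"
    and supp_g: "\<And>c w. modulus_supported (\<lambda>z. g (z * c)) w"
    and \<omega>: "continuous_on {z. a \<le> cmod z \<and> cmod z \<le> b} (\<lambda>z. \<omega> (cmod z))"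
    and supp_\<omega>: "\<And>w. a < cmod w \<Longrightarrow> cmod w < b \<Longrightarrow> modulus_supported (\<lambda>z. \<omega> (cmod z)) w"
    and bd: "\<And>\<rho>. \<rho> = a \<or> \<rho> = b \<Longrightarrow> 0 \<le> \<rho> \<Longrightarrow> \<omega> \<rho> * circle_mean g \<rho> \<le> B"
    and r: "0 \<le> r" "a \<le> r" "r \<le> b"
  shows "\<omega> r * circle_mean g r \<le> B"
proof (rule field_le_epsilon)
  fix E :: real
  assume "E > 0"
  \<comment> \<open>\<open>W\<close> dominates the sum of the weights at the three radii involved,
    so an error \<open>e\<close> in each mean costs at most \<open>E\<close> in total. The summand 1
    keeps it positive.\<close>
  define W where "W = 1 + \<bar>\<omega> a\<bar> + \<bar>\<omega> b\<bar> + \<bar>\<omega> r\<bar>"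
  define e where "e = E / W"
  have "W > 0" by (simp add: W_def)
  then have "e > 0" and We: "W * e = E" using \<open>E > 0\<close> by (simp_all add: e_def)
  define U where "U N z = (\<Sum>k<N. g (z * cis (2 * pi * real k / real N))) / real N" for N z
  have "\<forall>\<^sub>F N in sequentially. N > 0 \<and> (\<forall>\<rho>\<in>{a, b, r}. \<forall>z. cmod z = \<rho> \<longrightarrow> \<bar>U N z - circle_mean g \<rho>\<bar> \<le> e)"
    using circle_Riemann_sum[OF g \<open>e > 0\<close>] eventually_gt_at_top[of 0]
    by (auto simp: U_def intro!: eventually_conj)
  then obtain N where N: "N > 0"
    "\<And>z \<rho>. \<rho> \<in> {a, b, r} \<Longrightarrow> cmod z = \<rho> \<Longrightarrow> \<bar>U N z - circle_mean g \<rho>\<bar> \<le> e"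
    unfolding eventually_sequentially by blast
  have err: "\<bar>\<omega> \<rho> * U N z - \<omega> \<rho> * circle_mean g \<rho>\<bar> \<le> \<bar>\<omega> \<rho>\<bar> * e"
    if "\<rho> \<in> {a, b, r}" "cmod z = \<rho>" for \<rho> z
    using N(2)[OF that] by (simp add: abs_mult mult_left_mono flip: right_diff_distrib)
  \<comment> \<open>The average \<open>U N\<close> of finitely many rotates need not be radial, but
    on the circles of radius \<open>a\<close>, \<open>b\<close> and \<open>r\<close> it is within
    \<open>e\<close> of the circular mean. The pointwise maximum principle thus transfers to the
    means.\<close>
  have "\<omega> (cmod (of_real r)) * U N (of_real r) \<le> B + (\<bar>\<omega> a\<bar> + \<bar>\<omega> b\<bar>) * e"
  proof (rule modulus_supported_max_principle[where a = a and b = b])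
    show "continuous_on {z. a \<le> cmod z \<and> cmod z \<le> b} (\<lambda>z. \<omega> (cmod z) * U N z)"
      unfolding U_def
      by (intro continuous_intros \<omega> continuous_on_compose2[OF g]) (use N(1) in auto)
    show "modulus_supported (\<lambda>z. \<omega> (cmod z) * U N z) w" if "a < cmod w" "cmod w < b" for w
      unfolding U_def divide_inverse
      by (intro modulus_supported_mult supp_\<omega> modulus_supported_sum supp_g modulus_supported_const)
        (use that in auto)
    fix z :: complex
    assume z: "cmod z = a \<or> cmod z = b"
    then have "\<omega> (cmod z) * U N z \<le> \<omega> (cmod z) * circle_mean g (cmod z) + \<bar>\<omega> (cmod z)\<bar> * e"
      using err[of "cmod z" z] by auto
    moreover have "\<omega> (cmod z) * circle_mean g (cmod z) \<le> B"
      using z by (intro bd) auto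
    moreover have "\<bar>\<omega> (cmod z)\<bar> * e \<le> (\<bar>\<omega> a\<bar> + \<bar>\<omega> b\<bar>) * e"
      using z \<open>e > 0\<close> by (intro mult_right_mono) auto
    ultimately show "\<omega> (cmod z) * U N z \<le> B + (\<bar>\<omega> a\<bar> + \<bar>\<omega> b\<bar>) * e"
      by linarith
  qed (use r in auto)
  moreover have "\<omega> r * circle_mean g r \<le> \<omega> r * U N (of_real r) + \<bar>\<omega> r\<bar> * e"
    using err[of r "of_real r"] r(1) by auto
  ultimately have "\<omega> r * circle_mean g r \<le> B + (\<bar>\<omega> a\<bar> + \<bar>\<omega> b\<bar> + \<bar>\<omega> r\<bar>) * e"
    using r(1) by (simp add: algebra_simps)
  also have "\<dots> \<le> B + E"
    using We \<open>e > 0\<close> by (simp add: W_def algebra_simps)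
  finally show "\<omega> r * circle_mean g r \<le> B + E" .
qed

text \<open>Integrability is not assumed: in its absence the integral has the default value 0, which
  is also nonnegative.\<close>

lemma circle_mean_nonneg:
  assumes "\<And>z. g z \<ge> 0"
  shows "circle_mean g \<rho> \<ge> 0"
  unfolding circle_mean_def using assms
  by (metis (no_types, lifting) Henstock_Kurzweil_Integration.integral_nonneg
      not_integrable_integral order_refl divide_nonneg_nonneg pi_ge_zero mult_nonneg_nonneg zero_le_numeral)

section \<open>Integral means of entire functions and Hardy convexity\<close>

lemma ennpowr_ennreal: "x \<ge> 0 \<Longrightarrow> ennpowr (ennreal x) s = ennreal (x powr s)"
  by (simp add: ennpowr_def)

lemma integral_mean_finite_exponent:
  assumes f: "continuous_on UNIV f" and p: "p > 0" "p \<noteq> \<infinity>"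
  shows "integral_mean p f \<rho> =
    ennreal (circle_mean (\<lambda>z. cmod (f z) powr enn2real p) \<rho> powr (1 / enn2real p))"
proof -
  let ?g = "\<lambda>\<theta>. cmod (f (of_real \<rho> * cis \<theta>)) powr enn2real p"
  have "enn2real p > 0"
    using p by (simp add: enn2real_positive_iff less_top)
  then have "continuous_on {0..2 * pi} ?g"
    by (intro continuous_on_powr' continuous_intros continuous_on_compose2[OF f]) auto
  then have has: "(?g has_integral integral {0..2 * pi} ?g) {0..2 * pi}"
    by (intro integrable_integral integrable_continuous_real)
  then have "(\<integral>\<^sup>+\<theta>. indicator {0..2 * pi} \<theta> * ?g \<theta> \<partial>lborel) = ennreal (integral {0..2 * pi} ?g)"
    by (intro nn_integral_has_integral_lebesgue) auto
  then have "(\<integral>\<^sup>+\<theta>\<in>{0..2 * pi}. ennreal (?g \<theta>) \<partial>lborel) = ennreal (integral {0..2 * pi} ?g)"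
    by (simp add: mult.commute ennreal_mult'' ennreal_indicator)
  moreover have "integral {0..2 * pi} ?g \<ge> 0"
    by (rule has_integral_nonneg[OF has]) auto
  ultimately show ?thesis
    using p unfolding integral_mean_def
    by (simp add: cis_conv_exp circle_mean_def ennpowr_ennreal flip: ennreal_mult)
qed

text \<open>Compactness of the circle provides a point where the supremum is attained, and at such a
  point a pointwise maximum principle can be applied. The absolute value covers negative
  radii.\<close>

lemma integral_mean_infinity:
  assumes f: "continuous_on UNIV f"
  obtains z where "cmod z = \<bar>\<rho>\<bar>" "integral_mean \<infinity> f \<rho> = ennreal (cmod (f z))"
    "\<And>y. cmod y = \<bar>\<rho>\<bar> \<Longrightarrow> cmod (f y) \<le> cmod (f z)"
proof -
  have "compact (sphere (0::complex) \<bar>\<rho>\<bar>)" "sphere (0::complex) \<bar>\<rho>\<bar> \<noteq> {}"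
    by auto
  then obtain z where z: "z \<in> sphere 0 \<bar>\<rho>\<bar>" "\<And>y. y \<in> sphere 0 \<bar>\<rho>\<bar> \<Longrightarrow> cmod (f y) \<le> cmod (f z)"
    using continuous_attains_sup[of "sphere 0 \<bar>\<rho>\<bar>" "\<lambda>z. cmod (f z)"]
      continuous_on_norm[OF continuous_on_subset[OF f, of "sphere 0 \<bar>\<rho>\<bar>"]] by blast
  \<comment> \<open>For \<open>\<rho> = 0\<close> the circle is a single point and any angle
    represents it.\<close>
  define \<theta> where "\<theta> = (if \<rho> = 0 then 0 else Arg2pi (z / of_real \<rho>))"
  have \<theta>: "\<theta> \<in> {0..2 * pi}" "z = of_real \<rho> * exp (\<i> * of_real \<theta>)"
    using Arg2pi[of "z / of_real \<rho>"] z(1)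
    by (auto simp: \<theta>_def is_Arg_def norm_divide field_simps)
  have "integral_mean \<infinity> f \<rho> = ennreal (cmod (f z))"
    unfolding integral_mean_def
  proof (simp, intro antisym SUP_least)
    show "ennreal (cmod (f z)) \<le> (SUP \<theta>\<in>{0..2 * pi}. ennreal (cmod (f (of_real \<rho> * exp (\<i> * of_real \<theta>)))))"
      using \<theta> by (intro SUP_upper2[of \<theta>]) auto
  qed (auto intro!: ennreal_leI z(2) simp: norm_mult)
  then show ?thesis
    using that z by auto
qed

text \<open>Hardy's convexity theorem, stated as a maximum principle for \<open>\<rho> powr s * M \<rho>\<close> with all
  real \<open>s\<close>, which is equivalent to convexity of \<open>ln (M \<rho>)\<close> in \<open>ln \<rho>\<close>.\<close>

lemma integral_mean_convexity:
  assumes f: "f holomorphic_on UNIV" and p: "p > 0"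
  obtains M where "\<And>\<rho>. M \<rho> \<ge> 0" "\<And>\<rho>. integral_mean p f \<rho> = ennreal (M \<rho>)"
    "\<And>s a r b. 0 < a \<Longrightarrow> a \<le> r \<Longrightarrow> r \<le> b \<Longrightarrow> r powr s * M r \<le> max (a powr s * M a) (b powr s * M b)"
    "\<And>r b. 0 \<le> r \<Longrightarrow> r \<le> b \<Longrightarrow> M r \<le> M b"
proof (cases "p = \<infinity>")
  case False
  define P where "P = enn2real p"
  have P: "P > 0"
    using p False by (simp add: P_def enn2real_positive_iff less_top)
  define g where "g z = cmod (f z) powr P" for z
  have cont_f: "continuous_on UNIV f"
    using f by (rule holomorphic_on_imp_continuous_on)
  have cont_g: "continuous_on UNIV g"
    unfolding g_def using P cont_f by (intro continuous_on_powr' continuous_intros) auto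
  have supp_g: "modulus_supported (\<lambda>z. g (z * c)) w" for c w
    unfolding g_def using P f
    by (intro modulus_supported_norm_powr_pos[of UNIV] holomorphic_on_compose_gen[of "\<lambda>z. z * c" UNIV f, unfolded o_def])
      (auto intro!: holomorphic_intros)
  have g0: "circle_mean g \<rho> \<ge> 0" for \<rho>
    by (rule circle_mean_nonneg) (simp add: g_def)
  define M where "M \<rho> = circle_mean g \<rho> powr (1 / P)" for \<rho>
  show ?thesis
  proof (rule that[of M])
    show "integral_mean p f \<rho> = ennreal (M \<rho>)" for \<rho>
      using integral_mean_finite_exponent[OF cont_f p False] by (simp add: M_def g_def[abs_def] P_def)
  next
    fix s a r b :: real
    assume r: "0 < a" "a \<le> r" "r \<le> b"
    \<comment> \<open>The weight carries the exponent \<open>s * P\<close> because \<open>M\<close>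
      is the \<open>1 / P\<close>-th power of the circular mean; taking that power of
      \<open>?X\<close> gives \<open>\<rho> powr s * M \<rho>\<close>.\<close>
    let ?X = "\<lambda>\<rho>. \<rho> powr (s * P) * circle_mean g \<rho>"
    have X: "?X \<rho> powr (1 / P) = \<rho> powr s * M \<rho>" if "\<rho> > 0" for \<rho>
      using that g0 P by (simp add: powr_mult powr_powr M_def)
    have "?X r \<le> max (?X a) (?X b)"
    proof (rule circle_mean_max_principle[where a = a and b = b, OF cont_g supp_g])
      show "continuous_on {z. a \<le> cmod z \<and> cmod z \<le> b} (\<lambda>z. cmod z powr (s * P))"
        using r by (intro continuous_intros) auto
      show "modulus_supported (\<lambda>z. cmod z powr (s * P)) w" if "a < cmod w" "cmod w < b" for w
        using that r by (intro modulus_supported_norm_powr[of UNIV]) (auto intro: holomorphic_intros)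
    qed (use r in auto)
    then have "?X r powr (1 / P) \<le> max (?X a) (?X b) powr (1 / P)"
      using P g0 by (intro powr_mono2) auto
    also have "\<dots> \<le> max (?X a powr (1 / P)) (?X b powr (1 / P))"
      by (simp add: max_def)
    finally show "r powr s * M r \<le> max (a powr s * M a) (b powr s * M b)"
      using X r by simp
  next
    fix r b :: real
    assume r: "0 \<le> r" "r \<le> b"
    \<comment> \<open>With inner radius -1 the annulus is a full disc without inner boundary, and
      the constant weight 1 is admissible also at the origin.\<close>
    have "1 * circle_mean g r \<le> circle_mean g b"
      by (rule circle_mean_max_principle[where a = "-1" and b = b, OF cont_g supp_g])
        (use r in \<open>auto intro: modulus_supported_const\<close>)
    then show "M r \<le> M b"
      using g0 P by (auto simp: M_def intro: powr_mono2)
  qed (simp add: M_def)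
next
  case True
  have cont_f: "continuous_on S f" for S
    using f holomorphic_on_imp_continuous_on continuous_on_subset by blast
  \<comment> \<open>For infinite \<open>p\<close> the mean is the maximum modulus on the circle. The
    maximum point is recorded with it, so that the maximum principle applies directly, without
    averaging over rotations.\<close>
  have "\<exists>m\<ge>0. integral_mean p f \<rho> = ennreal m \<and> (\<exists>z. cmod z = \<bar>\<rho>\<bar> \<and> m = cmod (f z)) \<and>
    (\<forall>y. cmod y = \<bar>\<rho>\<bar> \<longrightarrow> cmod (f y) \<le> m)" for \<rho>
    using integral_mean_infinity[OF cont_f, of \<rho>] True by (metis norm_ge_zero)
  then obtain M where M: "\<And>\<rho>. M \<rho> \<ge> 0" "\<And>\<rho>. integral_mean p f \<rho> = ennreal (M \<rho>)"
    "\<And>\<rho>. \<exists>z. cmod z = \<bar>\<rho>\<bar> \<and> M \<rho> = cmod (f z)"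
    "\<And>\<rho> y. cmod y = \<bar>\<rho>\<bar> \<Longrightarrow> cmod (f y) \<le> M \<rho>"
    by metis
  have supp_f: "modulus_supported (\<lambda>z. cmod (f z)) w" for w
    using f by (intro modulus_supported_norm[of UNIV]) auto
  show ?thesis
  proof (rule that[of M, OF M(1,2)])
    fix s a r b :: real
    assume r: "0 < a" "a \<le> r" "r \<le> b"
    let ?B = "max (a powr s * M a) (b powr s * M b)"
    obtain z where z: "cmod z = \<bar>r\<bar>" "M r = cmod (f z)"
      using M(3) by blast
    have "cmod z powr s * cmod (f z) \<le> ?B"
    proof (rule modulus_supported_max_principle[where a = a and b = b and u = "\<lambda>z. cmod z powr s * cmod (f z)"])
      show "continuous_on {z. a \<le> cmod z \<and> cmod z \<le> b} (\<lambda>z. cmod z powr s * cmod (f z))"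
        using r by (intro continuous_intros cont_f) auto
      show "modulus_supported (\<lambda>z. cmod z powr s * cmod (f z)) w" if "a < cmod w" "cmod w < b" for w
        using that r
        by (intro modulus_supported_mult supp_f modulus_supported_norm_powr[of UNIV])
          (auto intro: holomorphic_intros)
      fix y :: complex
      assume y: "cmod y = a \<or> cmod y = b"
      have "cmod y powr s * cmod (f y) \<le> cmod y powr s * M (cmod y)"
        using M(4)[of y "cmod y"] by (simp add: mult_left_mono)
      also have "\<dots> \<le> ?B"
        using y by auto
      finally show "cmod y powr s * cmod (f y) \<le> ?B" .
    qed (use r z in auto)
    then show "r powr s * M r \<le> ?B"
      using z r by simp
  next
    fix r b :: real
    assume r: "0 \<le> r" "r \<le> b"
    obtain z where z: "cmod z = \<bar>r\<bar>" "M r = cmod (f z)"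
      using M(3) by blast
    have "cmod (f z) \<le> M b"
      by (rule modulus_supported_max_principle[where a = "-1" and b = b and u = "\<lambda>z. cmod (f z)"])
        (use r z in \<open>auto intro: supp_f M(4) continuous_on_norm cont_f dest: order.trans[OF norm_ge_zero eq_refl]\<close>)
    then show "M r \<le> M b"
      using z by simp
  qed
qed

subsection \<open>The upper bound\<close>

lemma ennpowr_le_1D:
  assumes "ennpowr X s \<le> 1" "s > 0"
  shows "X \<le> 1"
proof (cases X)
  case (real x)
  then have "x powr s \<le> 1 powr s"
    using assms by (simp add: ennpowr_ennreal ennreal_le_1)
  then have "x \<le> 1"
    using assms(2) real by (metis not_le powr_less_mono2 zero_le_one)
  then show ?thesis using real by (simp add: ennreal_le_1)
qed (use assms in \<open>simp add: ennpowr_def\<close>)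

lemma ennpowr_le_1I:
  assumes "X \<le> 1" "s > 0"
  shows "ennpowr X s \<le> 1"
proof (cases X)
  case (real x)
  then have "x powr s \<le> 1 powr s"
    using assms by (intro powr_mono2) (auto simp: ennreal_le_1)
  then show ?thesis using real by (simp add: ennpowr_ennreal ennreal_le_1)
qed (use assms in \<open>simp add: top_unique\<close>)

text \<open>For \<open>r \<ge> 1\<close> the Gaussian weight is replaced near \<open>r\<close> by a
  power of \<open>\<rho>\<close>. By convexity the mean with the power weight cannot drop below its
  value at \<open>r\<close> on both sides of \<open>r\<close>, so one of the two adjacent intervals
  of length \<open>1 / 2\<close> works. Its left end is at least \<open>r - 1 / 2\<close>, which is
  at least \<open>(1 + r) / 4\<close> when \<open>r \<ge> 1\<close>.\<close>

lemma weighted_mean_near_maximal: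
  fixes M :: "real \<Rightarrow> real"
  assumes \<alpha>: "\<alpha> > 0" and r: "r \<ge> 0" and M0: "\<And>\<rho>. M \<rho> \<ge> 0"
    and conv: "\<And>s a r b. 0 < a \<Longrightarrow> a \<le> r \<Longrightarrow> r \<le> b \<Longrightarrow> r powr s * M r \<le> max (a powr s * M a) (b powr s * M b)"
    and mono: "\<And>r b. 0 \<le> r \<Longrightarrow> r \<le> b \<Longrightarrow> M r \<le> M b"
  obtains a where "a \<ge> (1 + r) / 4"
    "\<And>\<rho>. \<rho> \<in> {a..a + 1 / 2} \<Longrightarrow>
      M r * exp (- (\<alpha> / 2) * r\<^sup>2) \<le> exp (2 * \<alpha>) * (M \<rho> * exp (- (\<alpha> / 2) * \<rho>\<^sup>2))"
proof (cases "r < 1")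
  case True
  show ?thesis
  \<comment> \<open>For small \<open>r\<close> monotonicity of the means suffices on
    \<open>{1..3 / 2}\<close>, where the Gaussian weight is at least
    \<open>exp (- 2 * \<alpha>)\<close>.\<close>
  proof (rule that[of 1])
    fix \<rho> :: real
    assume "\<rho> \<in> {1..1 + 1 / 2}"
    then have \<rho>: "1 \<le> \<rho>" "\<rho> \<le> 3 / 2" by auto
    have "\<rho>\<^sup>2 \<le> (3 / 2)\<^sup>2"
      using \<rho> by (intro power_mono) auto
    then have "\<alpha> * \<rho>\<^sup>2 \<le> \<alpha> * 4"
      using \<alpha> by (intro mult_left_mono) (auto simp: power2_eq_square)
    moreover have "0 \<le> \<alpha> * r\<^sup>2" using \<alpha> by simp
    ultimately have "exp (- (\<alpha> / 2) * r\<^sup>2) \<le> exp (2 * \<alpha> + - (\<alpha> / 2) * \<rho>\<^sup>2)"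
      by simp
    moreover have "M r \<le> M \<rho>"
      using r \<rho> True by (intro mono) auto
    ultimately have "M r * exp (- (\<alpha> / 2) * r\<^sup>2) \<le> M \<rho> * exp (2 * \<alpha> + - (\<alpha> / 2) * \<rho>\<^sup>2)"
      using M0 by (intro mult_mono) auto
    then show "M r * exp (- (\<alpha> / 2) * r\<^sup>2) \<le> exp (2 * \<alpha>) * (M \<rho> * exp (- (\<alpha> / 2) * \<rho>\<^sup>2))"
      unfolding exp_add by (simp add: mult_ac)
  qed (use True in auto)
next
  case False
  \<comment> \<open>With this exponent \<open>\<rho> powr s\<close> and
    \<open>exp (- (\<alpha> / 2) * \<rho>\<^sup>2)\<close> have the same logarithmic derivative
    \<open>- \<alpha> * r\<close> at \<open>\<rho> = r\<close>.\<close>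
  define s where "s = - \<alpha> * r\<^sup>2"
  have transfer: "M r * exp (- (\<alpha> / 2) * r\<^sup>2) \<le> exp (2 * \<alpha>) * (M \<rho> * exp (- (\<alpha> / 2) * \<rho>\<^sup>2))"
    if \<rho>: "\<bar>\<rho> - r\<bar> \<le> 1 / 2" "r powr s * M r \<le> \<rho> powr s * M \<rho>" for \<rho>
  proof -
    define v u where "v = \<rho> - r" and "u = v / r"
    have "\<rho> > 0" using \<rho>(1) False by linarith
    have v: "\<bar>v\<bar> \<le> 1 / 2" using \<rho> by (simp add: v_def)
    also have "1 / 2 \<le> 1 / 2 * r" using False by simp
    finally have "\<bar>u\<bar> \<le> 1 / 2" using False by (simp add: u_def field_simps)
    \<comment> \<open>The linear terms in \<open>v\<close> will cancel. What remains is at most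
      \<open>5 / 2 * \<alpha> * v\<^sup>2\<close>, well below \<open>2 * \<alpha>\<close> and, which
      is essential, bounded independently of \<open>r\<close>.\<close>
    then have "ln (1 + u) \<ge> u - 2 * u\<^sup>2"
      using abs_ln_one_plus_x_minus_x_bound[of u] by linarith
    moreover have "1 + u = \<rho> / r" using False by (simp add: u_def v_def field_simps)
    ultimately have "(\<alpha> * r\<^sup>2) * ln (\<rho> / r) \<ge> (\<alpha> * r\<^sup>2) * (u - 2 * u\<^sup>2)"
      using \<alpha> by (intro mult_left_mono) auto
    also have "(\<alpha> * r\<^sup>2) * (u - 2 * u\<^sup>2) = \<alpha> * r * v - 2 * \<alpha> * v\<^sup>2"
      using False by (simp add: u_def field_simps power2_eq_square)
    finally have ln: "s * ln (\<rho> / r) \<le> - \<alpha> * r * v + 2 * \<alpha> * v\<^sup>2"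
      by (simp add: s_def)
    have "v\<^sup>2 \<le> (1 / 2)\<^sup>2"
      using v by (metis abs_ge_zero power2_abs power_mono)
    then have "\<alpha> * v\<^sup>2 \<le> \<alpha> * (1 / 4)"
      using \<alpha> by (intro mult_left_mono) (auto simp: power2_eq_square)
    moreover have "(\<alpha> / 2) * \<rho>\<^sup>2 = (\<alpha> / 2) * r\<^sup>2 + \<alpha> * r * v + \<alpha> * v\<^sup>2 / 2"
      by (simp add: v_def power2_eq_square field_simps)
    ultimately have "s * ln (\<rho> / r) - (\<alpha> / 2) * r\<^sup>2 \<le> 2 * \<alpha> - (\<alpha> / 2) * \<rho>\<^sup>2"
      using ln \<alpha> by linarith
    then have e: "exp (s * ln (\<rho> / r) + - (\<alpha> / 2) * r\<^sup>2) \<le> exp (2 * \<alpha> + - (\<alpha> / 2) * \<rho>\<^sup>2)"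
      by simp
    have "M r = (r powr s * M r) / r powr s"
      using False by simp
    also have "\<dots> \<le> (\<rho> powr s * M \<rho>) / r powr s"
      using \<rho>(2) by (intro divide_right_mono) auto
    also have "\<dots> = exp (s * ln (\<rho> / r)) * M \<rho>"
      using False \<open>\<rho> > 0\<close> by (simp add: powr_def ln_div exp_diff algebra_simps)
    finally have "M r * exp (- (\<alpha> / 2) * r\<^sup>2) \<le> M \<rho> * exp (s * ln (\<rho> / r) + - (\<alpha> / 2) * r\<^sup>2)"
      unfolding exp_add by (simp add: mult_ac)
    also have "\<dots> \<le> M \<rho> * exp (2 * \<alpha> + - (\<alpha> / 2) * \<rho>\<^sup>2)"
      using e M0 by (intro mult_left_mono) auto
    finally show ?thesis
      unfolding exp_add by (simp add: mult_ac)
  qed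
  show ?thesis
  proof (cases "\<forall>\<rho>\<in>{r - 1 / 2..r}. r powr s * M r \<le> \<rho> powr s * M \<rho>")
    case True
    then show ?thesis
      using False transfer by (intro that[of "r - 1 / 2"]) auto
  next
    case nonmax: False
    then obtain \<rho>' where \<rho>': "\<rho>' \<in> {r - 1 / 2..r}" "\<rho>' powr s * M \<rho>' < r powr s * M r"
      by force
    \<comment> \<open>Between \<open>\<rho>'\<close> and \<open>\<rho>\<close> the maximum principle
      bounds the value at \<open>r\<close> by one of the end values; the one at
      \<open>\<rho>'\<close> is too small, so it is the one at \<open>\<rho>\<close>.\<close>
    have "r powr s * M r \<le> \<rho> powr s * M \<rho>" if "\<rho> \<in> {r..r + 1 / 2}" for \<rho>
      using conv[of \<rho>' r \<rho> s] \<rho>' that False by auto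
    then show ?thesis
      using False transfer by (intro that[of r]) auto
  qed
qed

text \<open>The norm integral is bounded below by its part over the interval from
  \<open>weighted_mean_near_maximal\<close>. There the density factor \<open>\<rho>\<close> is at
  least \<open>(1 + r) / 4\<close>, the source of the gain \<open>(1 + r) powr (- (1 / q))\<close>.
  No constant involves \<open>p\<close>.\<close>

lemma integral_mean_le_growth:
  assumes \<alpha>: "\<alpha> > 0" and q: "q > 0" "q \<noteq> \<infinity>" and p: "p > 0" and r: "r \<ge> 0"
    and f: "f holomorphic_on UNIV" "fock_norm \<alpha> p q f \<le> 1"
  shows "integral_mean p f r \<le>
    ennreal ((8 / (\<alpha> * enn2real q)) powr (1 / enn2real q) * exp (2 * \<alpha>) *
      ((1 + r) powr (- (1 / enn2real q)) * exp (\<alpha> / 2 * r\<^sup>2)))"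
proof -
  define Q where "Q = enn2real q"
  have Q: "Q > 0"
    using q by (simp add: Q_def enn2real_positive_iff less_top)
  obtain M where M: "\<And>\<rho>. M \<rho> \<ge> 0" "\<And>\<rho>. integral_mean p f \<rho> = ennreal (M \<rho>)"
    "\<And>s a r b. 0 < a \<Longrightarrow> a \<le> r \<Longrightarrow> r \<le> b \<Longrightarrow> r powr s * M r \<le> max (a powr s * M a) (b powr s * M b)"
    "\<And>r b. 0 \<le> r \<Longrightarrow> r \<le> b \<Longrightarrow> M r \<le> M b"
    using integral_mean_convexity[OF f(1) p] by blast
  obtain a where a: "a \<ge> (1 + r) / 4"
    "\<And>\<rho>. \<rho> \<in> {a..a + 1 / 2} \<Longrightarrow>
      M r * exp (- (\<alpha> / 2) * r\<^sup>2) \<le> exp (2 * \<alpha>) * (M \<rho> * exp (- (\<alpha> / 2) * \<rho>\<^sup>2))"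
    using weighted_mean_near_maximal[OF \<alpha> r M(1,3,4)] by blast
  \<comment> \<open>A lower bound for the weighted mean on the whole interval: its value at
    \<open>r\<close> reduced by the loss \<open>exp (2 * \<alpha>)\<close>.\<close>
  define L where "L = M r * exp (- (\<alpha> / 2) * r\<^sup>2) * exp (- 2 * \<alpha>)"
  have L0: "L \<ge> 0" using M(1) by (simp add: L_def)
  define X where "X = L powr Q * (\<alpha> * Q * ((1 + r) / 4))"
  have X0: "X \<ge> 0" using \<alpha> Q r by (simp add: X_def)
  have low: "X \<le> M \<rho> powr Q * (\<alpha> * Q * exp (- (\<alpha> * Q / 2) * \<rho>\<^sup>2) * \<rho>)"
    if \<rho>: "\<rho> \<in> {a..a + 1 / 2}" for \<rho>
  proof -
    have "L \<le> exp (2 * \<alpha>) * (M \<rho> * exp (- (\<alpha> / 2) * \<rho>\<^sup>2)) * exp (- 2 * \<alpha>)"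
      unfolding L_def by (intro mult_right_mono a(2) \<rho>) auto
    also have "\<dots> = M \<rho> * exp (- (\<alpha> / 2) * \<rho>\<^sup>2)"
      by (simp add: exp_minus)
    finally have "L powr Q \<le> (M \<rho> * exp (- (\<alpha> / 2) * \<rho>\<^sup>2)) powr Q"
      using L0 Q by (intro powr_mono2) auto
    also have "\<dots> = M \<rho> powr Q * exp (- (\<alpha> * Q / 2) * \<rho>\<^sup>2)"
      using M(1) by (simp add: powr_mult exp_powr_real mult_ac)
    finally have "X \<le> (M \<rho> powr Q * exp (- (\<alpha> * Q / 2) * \<rho>\<^sup>2)) * (\<alpha> * Q * \<rho>)"
      unfolding X_def using \<alpha> Q r a(1) \<rho> by (intro mult_mono) auto
    then show ?thesis by (simp add: mult_ac)
  qed
  have "ennreal X * ennreal (1 / 2) = (\<integral>\<^sup>+\<rho>. ennreal X * indicator {a..a + 1 / 2} \<rho> \<partial>lborel)"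
    by (simp add: nn_integral_cmult_indicator)
  also have "\<dots> \<le> (\<integral>\<^sup>+\<rho>\<in>{0..}. ennpowr (integral_mean p f \<rho>) Q *
      ennreal (\<alpha> * Q * exp (- (\<alpha> * Q / 2) * \<rho>\<^sup>2) * \<rho>) \<partial>lborel)"
  proof (rule nn_integral_mono)
    fix \<rho> :: real
    show "ennreal X * indicator {a..a + 1 / 2} \<rho> \<le> ennpowr (integral_mean p f \<rho>) Q *
      ennreal (\<alpha> * Q * exp (- (\<alpha> * Q / 2) * \<rho>\<^sup>2) * \<rho>) * indicator {0..} \<rho>"
    proof (cases "\<rho> \<in> {a..a + 1 / 2}")
      case True
      then have "\<rho> \<in> {0..}" using a(1) r by auto
      then show ?thesis
        using low[OF True] True M \<alpha> Q
        by (simp add: ennpowr_ennreal ennreal_leI flip: ennreal_mult)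
    qed simp
  qed
  also have "\<dots> \<le> 1"
    using f(2) q Q unfolding fock_norm_def by (auto simp: Q_def intro: ennpowr_le_1D)
  finally have "ennreal (X * (1 / 2)) \<le> 1"
    using X0 by (subst ennreal_mult) auto
  then have "X * (1 / 2) \<le> 1"
    by (simp only: ennreal_le_1)
  \<comment> \<open>The 8 combines the interval length \<open>1 / 2\<close> with the factor
    \<open>1 / 4\<close> from the bound on \<open>a\<close>.\<close>
  then have "L powr Q * (\<alpha> * Q * (1 + r)) \<le> 8"
    by (simp add: X_def mult_ac)
  then have "L powr Q \<le> 8 / (\<alpha> * Q * (1 + r))"
    using \<alpha> Q r by (subst pos_le_divide_eq) auto
  then have "L powr Q \<le> 8 / (\<alpha> * Q) * (1 / (1 + r))"
    by simp
  then have "(L powr Q) powr (1 / Q) \<le> (8 / (\<alpha> * Q) * (1 / (1 + r))) powr (1 / Q)"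
    using Q by (intro powr_mono2) auto
  also have "(L powr Q) powr (1 / Q) = L"
    using L0 Q by (simp add: powr_powr)
  also have "(8 / (\<alpha> * Q) * (1 / (1 + r))) powr (1 / Q) = (8 / (\<alpha> * Q)) powr (1 / Q) * (1 + r) powr (- (1 / Q))"
    using \<alpha> Q r by (simp add: powr_mult powr_divide powr_minus_divide)
  finally have L: "L \<le> (8 / (\<alpha> * Q)) powr (1 / Q) * (1 + r) powr (- (1 / Q))" .
  have "M r = L * (exp (2 * \<alpha>) * exp (\<alpha> / 2 * r\<^sup>2))"
    by (simp add: L_def exp_minus field_simps)
  also have "\<dots> \<le> (8 / (\<alpha> * Q)) powr (1 / Q) * (1 + r) powr (- (1 / Q)) * (exp (2 * \<alpha>) * exp (\<alpha> / 2 * r\<^sup>2))"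
    using L by (intro mult_right_mono) auto
  finally show ?thesis
    unfolding M(2) Q_def[symmetric] by (intro ennreal_leI) (simp add: mult_ac)
qed

subsection \<open>Extremal monomials\<close>

text \<open>Since \<open>(\<rho> / r) ^ n \<le> exp (n * (\<rho> / r - 1))\<close>, the choice \<open>n \<approx> \<alpha> * r\<^sup>2\<close> turns the weighted
  monomial into a Gaussian centred at \<open>r\<close>.\<close>

lemma weighted_monomial_le:
  fixes \<alpha> r \<rho> :: real
  assumes \<alpha>: "\<alpha> > 0" and r: "r \<ge> 0" and \<rho>: "\<rho> \<ge> 0" and n: "n = nat \<lfloor>\<alpha> * r\<^sup>2\<rfloor>"
  shows "\<rho> ^ n * exp (- (\<alpha> / 2) * \<rho>\<^sup>2) \<le>
    exp 1 * (r ^ n * exp (- (\<alpha> / 2) * r\<^sup>2)) * exp (- (\<alpha> / 2) * (\<rho> - r)\<^sup>2)"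
proof -
  have x0: "0 \<le> \<alpha> * r\<^sup>2" using \<alpha> by simp
  have nx: "real n \<le> \<alpha> * r\<^sup>2" "\<alpha> * r\<^sup>2 < real n + 1"
    using x0 unfolding n by linarith+
  have "\<rho> ^ n \<le> r ^ n * exp (1 - \<alpha> * r\<^sup>2 + \<alpha> * r * \<rho>)"
  proof (cases "n = 0")
    case True
    \<comment> \<open>When \<open>n = 0\<close> one has \<open>\<alpha> * r\<^sup>2 < 1\<close>, so
      the exponent on the right is nonnegative.\<close>
    have "0 \<le> \<alpha> * r * \<rho>" using \<alpha> r \<rho> by simp
    then show ?thesis using nx True by simp
  next
    case False
    have "r > 0" using False nx r by (cases "r = 0") auto
    define t where "t = \<rho> / r - 1"
    have t: "t \<ge> -1" using \<rho> \<open>r > 0\<close> by (simp add: t_def)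
    have "\<rho> / r \<le> exp t" using exp_ge_add_one_self[of t] by (simp add: t_def)
    then have "(\<rho> / r) ^ n \<le> exp t ^ n"
      using \<rho> r by (intro power_mono) auto
    also have "\<dots> = exp (real n * t)"
      by (simp add: exp_of_nat_mult)
    \<comment> \<open>Replacing \<open>n\<close> by \<open>\<alpha> * r\<^sup>2\<close> changes it
      by less than 1; as \<open>t \<ge> -1\<close>, this costs at most a factor
      \<open>exp 1\<close>.\<close>
    also have "\<dots> \<le> exp (1 + \<alpha> * r\<^sup>2 * t)"
    proof -
      have "(\<alpha> * r\<^sup>2 - real n) * (- 1) \<le> (\<alpha> * r\<^sup>2 - real n) * t"
        using nx t by (intro mult_left_mono) auto
      then show ?thesis using nx by (simp add: algebra_simps)
    qed
    also have "1 + \<alpha> * r\<^sup>2 * t = 1 - \<alpha> * r\<^sup>2 + \<alpha> * r * \<rho>"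
      using \<open>r > 0\<close> by (simp add: t_def field_simps power2_eq_square)
    finally show ?thesis
      using \<open>r > 0\<close> by (simp add: power_divide field_simps)
  qed
  then have "\<rho> ^ n * exp (- (\<alpha> / 2) * \<rho>\<^sup>2) \<le>
      r ^ n * exp (1 - \<alpha> * r\<^sup>2 + \<alpha> * r * \<rho>) * exp (- (\<alpha> / 2) * \<rho>\<^sup>2)"
    by (intro mult_right_mono) auto
  also have "\<dots> = r ^ n * exp (1 - \<alpha> * r\<^sup>2 + \<alpha> * r * \<rho> + - (\<alpha> / 2) * \<rho>\<^sup>2)"
    by (simp only: exp_add mult.assoc)
  \<comment> \<open>Completing the square in \<open>\<rho> - r\<close>.\<close>
  also have "1 - \<alpha> * r\<^sup>2 + \<alpha> * r * \<rho> + - (\<alpha> / 2) * \<rho>\<^sup>2 =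
      1 + - (\<alpha> / 2) * r\<^sup>2 + - (\<alpha> / 2) * (\<rho> - r)\<^sup>2"
    by (simp add: power2_eq_square field_simps)
  also have "r ^ n * exp \<dots> =
      exp 1 * (r ^ n * exp (- (\<alpha> / 2) * r\<^sup>2)) * exp (- (\<alpha> / 2) * (\<rho> - r)\<^sup>2)"
    by (simp only: exp_add mult_ac)
  finally show ?thesis .
qed

text \<open>The modulus of a monomial is constant on circles, so its means agree for all
  \<open>p\<close>. This makes the lower constant independent of \<open>p\<close>.\<close>

lemma integral_mean_monomial:
  assumes p: "p > 0" and c: "c \<ge> 0" and \<rho>: "\<rho> \<ge> 0"
  shows "integral_mean p (\<lambda>z. of_real c * z ^ n) \<rho> = ennreal (c * \<rho> ^ n)"
proof (cases "p = \<infinity>")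
  case True
  have "{0..2 * pi} \<noteq> {}" by simp
  then show ?thesis
    using True c \<rho> by (simp add: integral_mean_def norm_mult norm_power)
next
  case False
  have P: "enn2real p > 0"
    using p False by (simp add: enn2real_positive_iff less_top)
  have "circle_mean (\<lambda>z. cmod (of_real c * z ^ n) powr enn2real p) \<rho> = (c * \<rho> ^ n) powr enn2real p"
    using c \<rho> by (simp add: circle_mean_def norm_mult norm_power)
  moreover have "((c * \<rho> ^ n) powr enn2real p) powr (1 / enn2real p) = c * \<rho> ^ n"
    using P c \<rho> by (simp add: powr_powr)
  ultimately show ?thesis
    by (subst integral_mean_finite_exponent) (use p False in \<open>auto intro!: continuous_intros\<close>)
qed

text \<open>A combination of the zeroth and second central moments of the normal density with mean
  \<open>r\<close> and variance \<open>1 / \<beta>\<close>. The factor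
  \<open>2 + (\<rho> - r)\<^sup>2\<close> is what remains of the density \<open>\<rho>\<close> after
  \<open>1 + r\<close> has been split off.\<close>

lemma nn_integral_gaussian_moment:
  fixes \<beta> r :: real
  assumes \<beta>: "\<beta> > 0"
  shows "(\<integral>\<^sup>+\<rho>. ennreal (exp (- (\<beta> / 2) * (\<rho> - r)\<^sup>2) * (2 + (\<rho> - r)\<^sup>2)) \<partial>lborel) =
    ennreal (sqrt (2 * pi / \<beta>) * (2 + 1 / \<beta>))"
proof -
  define \<sigma> where "\<sigma> = 1 / sqrt \<beta>"
  have \<sigma>: "\<sigma> > 0" "\<sigma>\<^sup>2 = 1 / \<beta>"
    using \<beta> by (simp_all add: \<sigma>_def power_divide)
  have "has_bochner_integral lborel
      (\<lambda>x. sqrt (2 * pi / \<beta>) * (2 * (normal_density r \<sigma> x * (x - r) ^ (2 * 0)) + normal_density r \<sigma> x * (x - r) ^ (2 * 1)))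
      (sqrt (2 * pi / \<beta>) * (2 * (fact (2 * 0) / ((2 / \<sigma>\<^sup>2) ^ 0 * fact 0)) + fact (2 * 1) / ((2 / \<sigma>\<^sup>2) ^ 1 * fact 1)))"
    using \<sigma>(1) by (intro has_bochner_integral_mult_right has_bochner_integral_add normal_moment_even) auto
  moreover have "sqrt (2 * pi / \<beta>) * normal_density r \<sigma> x = exp (- (\<beta> / 2) * (x - r)\<^sup>2)" for x
    using \<beta> by (simp add: normal_density_def \<sigma>)
  then have "sqrt (2 * pi / \<beta>) * (2 * (normal_density r \<sigma> x * (x - r) ^ (2 * 0)) + normal_density r \<sigma> x * (x - r) ^ (2 * 1))
      = exp (- (\<beta> / 2) * (x - r)\<^sup>2) * (2 + (x - r)\<^sup>2)" for x
    by (simp only: distrib_left distrib_right mult.assoc[symmetric] mult.left_commute[of _ 2]) (simp add: mult_ac)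
  moreover have "sqrt (2 * pi / \<beta>) * (2 * (fact (2 * 0) / ((2 / \<sigma>\<^sup>2) ^ 0 * fact 0)) + fact (2 * 1) / ((2 / \<sigma>\<^sup>2) ^ 1 * fact 1))
      = sqrt (2 * pi / \<beta>) * (2 + 1 / \<beta>)"
    using \<beta> by (simp add: \<sigma>(2))
  ultimately have "has_bochner_integral lborel (\<lambda>x. exp (- (\<beta> / 2) * (x - r)\<^sup>2) * (2 + (x - r)\<^sup>2))
      (sqrt (2 * pi / \<beta>) * (2 + 1 / \<beta>))"
    by (simp only:)
  then show ?thesis
    by (subst nn_integral_eq_integral) (auto simp: has_bochner_integral_iff)
qed

text \<open>The monomial is concentrated in a Gaussian around \<open>r\<close>, so its norm integral
  is at most its peak to the power \<open>q\<close> times \<open>K * (1 + r)\<close>. The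
  coefficient is scaled to make this bound equal to 1.\<close>

lemma monomial_extremal_finite:
  assumes \<alpha>: "\<alpha> > 0" and q: "q > 0" "q \<noteq> \<infinity>" and p: "p > 0" and r: "r \<ge> 0"
    and K: "K = \<alpha> * enn2real q * (sqrt (2 * pi / (\<alpha> * enn2real q)) * (2 + 1 / (\<alpha> * enn2real q)))"
  obtains f where "f holomorphic_on UNIV" "fock_norm \<alpha> p q f \<le> 1"
    "integral_mean p f r = ennreal (exp (- 1) * K powr (- (1 / enn2real q)) *
      ((1 + r) powr (- (1 / enn2real q)) * exp (\<alpha> / 2 * r\<^sup>2)))"
proof -
  define Q where "Q = enn2real q"
  have Q: "Q > 0"
    using q by (simp add: Q_def enn2real_positive_iff less_top)
  have \<alpha>Q: "\<alpha> * Q > 0" using \<alpha> Q by simp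
  have K0: "K > 0"
    using \<alpha> Q unfolding K Q_def[symmetric] by (intro mult_pos_pos add_pos_pos) auto
  define n where "n = nat \<lfloor>\<alpha> * r\<^sup>2\<rfloor>"
  \<comment> \<open>The peak bound for the weighted monomial given by
    \<open>weighted_monomial_le\<close>.\<close>
  define b where "b = exp 1 * (r ^ n * exp (- (\<alpha> / 2) * r\<^sup>2))"
  have rn: "r ^ n > 0"
    using r by (cases "r = 0") (auto simp: n_def)
  then have b: "b > 0" by (simp add: b_def)
  \<comment> \<open>Solves \<open>(c * b) powr Q * (K * (1 + r)) = 1\<close>.\<close>
  define c where "c = (K * (1 + r)) powr (- (1 / Q)) / b"
  have c: "c > 0" using K0 r b by (simp add: c_def)
  define f :: "complex \<Rightarrow> complex" where "f z = of_real c * z ^ n" for z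
  have mean: "integral_mean p f \<rho> = ennreal (c * \<rho> ^ n)" if "\<rho> \<ge> 0" for \<rho>
    unfolding f_def using integral_mean_monomial[OF p _ that] c by simp
  have cb: "(c * b) powr Q = 1 / (K * (1 + r))"
  proof -
    have "c * b = (K * (1 + r)) powr (- (1 / Q))"
      using b by (simp add: c_def)
    then have "(c * b) powr Q = (K * (1 + r)) powr (- 1)"
      using Q by (simp add: powr_powr)
    also have "\<dots> = 1 / (K * (1 + r))"
      using K0 r by (subst powr_minus_divide) auto
    finally show ?thesis .
  qed
  have le: "(c * \<rho> ^ n) powr Q * (\<alpha> * Q * exp (- (\<alpha> * Q / 2) * \<rho>\<^sup>2) * \<rho>) \<le>
      \<alpha> * Q / K * (exp (- (\<alpha> * Q / 2) * (\<rho> - r)\<^sup>2) * (2 + (\<rho> - r)\<^sup>2))"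
    if \<rho>: "\<rho> \<ge> 0" for \<rho>
  proof -
    have "c * (\<rho> ^ n * exp (- (\<alpha> / 2) * \<rho>\<^sup>2)) \<le> c * (b * exp (- (\<alpha> / 2) * (\<rho> - r)\<^sup>2))"
      unfolding b_def using c by (intro mult_left_mono weighted_monomial_le \<alpha> r \<rho> n_def) auto
    then have "(c * (\<rho> ^ n * exp (- (\<alpha> / 2) * \<rho>\<^sup>2))) powr Q \<le> (c * (b * exp (- (\<alpha> / 2) * (\<rho> - r)\<^sup>2))) powr Q"
      using Q c \<rho> by (intro powr_mono2) auto
    also have "(c * (\<rho> ^ n * exp (- (\<alpha> / 2) * \<rho>\<^sup>2))) powr Q = (c * \<rho> ^ n) powr Q * exp (- (\<alpha> * Q / 2) * \<rho>\<^sup>2)"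
      using c \<rho> by (simp add: powr_mult exp_powr_real mult_ac)
    also have "(c * (b * exp (- (\<alpha> / 2) * (\<rho> - r)\<^sup>2))) powr Q = (c * b) powr Q * exp (- (\<alpha> * Q / 2) * (\<rho> - r)\<^sup>2)"
      using c b by (simp add: powr_mult exp_powr_real mult_ac)
    finally have 1: "(c * \<rho> ^ n) powr Q * exp (- (\<alpha> * Q / 2) * \<rho>\<^sup>2) \<le>
        1 / (K * (1 + r)) * exp (- (\<alpha> * Q / 2) * (\<rho> - r)\<^sup>2)"
      unfolding cb .
    \<comment> \<open>This separates the growth in \<open>r\<close> from the deviation
      \<open>\<rho> - r\<close>, leaving a Gaussian moment that does not depend on
      \<open>r\<close>.\<close>
    have 2: "\<rho> \<le> (1 + r) * (2 + (\<rho> - r)\<^sup>2)"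
    proof -
      have "0 \<le> (\<rho> - r - 1 / 2)\<^sup>2" by simp
      then have "\<rho> - r \<le> 1 + (\<rho> - r)\<^sup>2" by (simp add: power2_eq_square algebra_simps)
      moreover have "0 \<le> r * (1 + (\<rho> - r)\<^sup>2)" using r by simp
      ultimately show ?thesis by (simp add: algebra_simps)
    qed
    have "((c * \<rho> ^ n) powr Q * exp (- (\<alpha> * Q / 2) * \<rho>\<^sup>2)) * (\<alpha> * Q * \<rho>) \<le>
        (1 / (K * (1 + r)) * exp (- (\<alpha> * Q / 2) * (\<rho> - r)\<^sup>2)) * (\<alpha> * Q * ((1 + r) * (2 + (\<rho> - r)\<^sup>2)))"
      using \<alpha> Q \<rho> K0 r by (intro mult_mono[OF 1] mult_left_mono[OF 2]) auto
    also have "\<dots> = \<alpha> * Q / K * (exp (- (\<alpha> * Q / 2) * (\<rho> - r)\<^sup>2) * (2 + (\<rho> - r)\<^sup>2)) * ((1 + r) / (1 + r))"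
      by simp
    finally show ?thesis using r by (simp add: mult_ac)
  qed
  have "(\<integral>\<^sup>+\<rho>\<in>{0..}. ennpowr (integral_mean p f \<rho>) Q *
      ennreal (\<alpha> * Q * exp (- (\<alpha> * Q / 2) * \<rho>\<^sup>2) * \<rho>) \<partial>lborel) \<le>
    (\<integral>\<^sup>+\<rho>. ennreal (\<alpha> * Q / K) * ennreal (exp (- (\<alpha> * Q / 2) * (\<rho> - r)\<^sup>2) * (2 + (\<rho> - r)\<^sup>2)) \<partial>lborel)"
  proof (rule nn_integral_mono)
    fix \<rho> :: real
    show "ennpowr (integral_mean p f \<rho>) Q * ennreal (\<alpha> * Q * exp (- (\<alpha> * Q / 2) * \<rho>\<^sup>2) * \<rho>) * indicator {0..} \<rho>
      \<le> ennreal (\<alpha> * Q / K) * ennreal (exp (- (\<alpha> * Q / 2) * (\<rho> - r)\<^sup>2) * (2 + (\<rho> - r)\<^sup>2))"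
    proof (cases "\<rho> \<ge> 0")
      case True
      have "ennpowr (integral_mean p f \<rho>) Q * ennreal (\<alpha> * Q * exp (- (\<alpha> * Q / 2) * \<rho>\<^sup>2) * \<rho>) =
          ennreal ((c * \<rho> ^ n) powr Q * (\<alpha> * Q * exp (- (\<alpha> * Q / 2) * \<rho>\<^sup>2) * \<rho>))"
        using True c \<alpha> Q by (simp add: mean ennpowr_ennreal flip: ennreal_mult)
      also have "\<dots> \<le> ennreal (\<alpha> * Q / K * (exp (- (\<alpha> * Q / 2) * (\<rho> - r)\<^sup>2) * (2 + (\<rho> - r)\<^sup>2)))"
        by (intro ennreal_leI le True)
      also have "\<dots> = ennreal (\<alpha> * Q / K) * ennreal (exp (- (\<alpha> * Q / 2) * (\<rho> - r)\<^sup>2) * (2 + (\<rho> - r)\<^sup>2))"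
        using \<alpha>Q K0 by (intro ennreal_mult) auto
      finally show ?thesis using True by simp
    qed simp
  qed
  also have "\<dots> = ennreal (\<alpha> * Q / K) * ennreal (sqrt (2 * pi / (\<alpha> * Q)) * (2 + 1 / (\<alpha> * Q)))"
    by (subst nn_integral_cmult) (auto simp: nn_integral_gaussian_moment[OF \<alpha>Q, simplified])
  also have "\<dots> = ennreal (\<alpha> * Q / K * (sqrt (2 * pi / (\<alpha> * Q)) * (2 + 1 / (\<alpha> * Q))))"
    using \<alpha>Q K0 by (intro ennreal_mult[symmetric]) (auto intro!: mult_nonneg_nonneg add_nonneg_nonneg)
  also have "\<alpha> * Q / K * (sqrt (2 * pi / (\<alpha> * Q)) * (2 + 1 / (\<alpha> * Q))) = 1"
    using K0 unfolding times_divide_eq_left K Q_def[symmetric] by (intro divide_self) auto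
  finally have "fock_norm \<alpha> p q f \<le> 1"
    unfolding fock_norm_def Q_def[symmetric] using q Q by (auto intro!: ennpowr_le_1I)
  moreover have "f holomorphic_on UNIV"
    unfolding f_def by (intro holomorphic_intros)
  \<comment> \<open>The powers of \<open>r\<close> cancel against those in \<open>b\<close>; the
    remaining \<open>exp (- 1)\<close> is the cost of rounding \<open>\<alpha> * r\<^sup>2\<close>
    to an integer.\<close>
  moreover have "c * r ^ n = exp (- 1) * K powr (- (1 / Q)) * ((1 + r) powr (- (1 / Q)) * exp (\<alpha> / 2 * r\<^sup>2))"
  proof -
    define x where "x = r ^ n"
    have "x > 0" using rn by (simp add: x_def)
    then show ?thesis
      unfolding c_def b_def x_def[symmetric] powr_mult
      by (simp add: exp_minus field_simps)
  qed
  ultimately show ?thesis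
    using that[of f] mean[OF r] by (simp add: Q_def)
qed

text \<open>Here only the peak matters: the Gaussian factor is bounded by 1, so division by
  \<open>b\<close> normalises the monomial.\<close>

lemma monomial_extremal_infinity:
  assumes \<alpha>: "\<alpha> > 0" and p: "p > 0" and r: "r \<ge> 0"
  obtains f where "f holomorphic_on UNIV" "fock_norm \<alpha> p \<infinity> f \<le> 1"
    "integral_mean p f r = ennreal (exp (- 1) * exp (\<alpha> / 2 * r\<^sup>2))"
proof -
  define n where "n = nat \<lfloor>\<alpha> * r\<^sup>2\<rfloor>"
  define b where "b = exp 1 * (r ^ n * exp (- (\<alpha> / 2) * r\<^sup>2))"
  have rn: "r ^ n > 0"
    using r by (cases "r = 0") (auto simp: n_def)
  then have b: "b > 0" by (simp add: b_def)
  define f :: "complex \<Rightarrow> complex" where "f z = of_real (1 / b) * z ^ n" for z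
  have mean: "integral_mean p f \<rho> = ennreal (1 / b * \<rho> ^ n)" if "\<rho> \<ge> 0" for \<rho>
    unfolding f_def using b by (intro integral_mean_monomial p that) auto
  have "integral_mean p f \<rho> * ennreal (exp (- (\<alpha> / 2) * \<rho>\<^sup>2)) \<le> 1" if \<rho>: "\<rho> \<ge> 0" for \<rho>
  proof -
    have "\<rho> ^ n * exp (- (\<alpha> / 2) * \<rho>\<^sup>2) \<le> b * exp (- (\<alpha> / 2) * (\<rho> - r)\<^sup>2)"
      unfolding b_def by (intro weighted_monomial_le \<alpha> r \<rho> n_def)
    also have "\<dots> \<le> b * 1"
      using b \<alpha> by (intro mult_left_mono) auto
    finally have "1 / b * \<rho> ^ n * exp (- (\<alpha> / 2) * \<rho>\<^sup>2) \<le> 1"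
      using b by (simp add: field_simps)
    then show ?thesis
      using b \<rho> by (simp add: mean ennreal_le_1 flip: ennreal_mult)
  qed
  then have "fock_norm \<alpha> p \<infinity> f \<le> 1"
    unfolding fock_norm_def by (auto intro!: SUP_least)
  moreover have "f holomorphic_on UNIV"
    unfolding f_def by (intro holomorphic_intros)
  moreover have "1 / b * r ^ n = exp (- 1) * exp (\<alpha> / 2 * r\<^sup>2)"
  proof -
    define x where "x = r ^ n"
    have "x > 0" using rn by (simp add: x_def)
    then show ?thesis
      unfolding b_def x_def[symmetric] by (simp add: exp_minus field_simps)
  qed
  ultimately show ?thesis
    using that[of f] mean[OF r] by simp
qed

section \<open>Combination of the two bounds\<close>

theorem corollary2p3:
  fixes \<alpha> :: real and q :: ennreal
  assumes "\<alpha> > 0" and "q > 0"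
  shows "\<exists>c C :: real. c > 0 \<and> C > 0 \<and>
    (\<forall>p :: ennreal. p > 0 \<longrightarrow> (\<forall>r :: real. r \<ge> 0 \<longrightarrow>
       ennreal (c * ((1 + r) powr (- enn2real (1 / q)) * exp (\<alpha> / 2 * r\<^sup>2)))
         \<le> (SUP f \<in> {f \<in> fock_space \<alpha> p q. fock_norm \<alpha> p q f \<le> 1}. integral_mean p f r) \<and>
       (SUP f \<in> {f \<in> fock_space \<alpha> p q. fock_norm \<alpha> p q f \<le> 1}. integral_mean p f r)
         \<le> ennreal (C * ((1 + r) powr (- enn2real (1 / q)) * exp (\<alpha> / 2 * r\<^sup>2)))))"
proof -
  note \<alpha> = \<open>\<alpha> > 0\<close>
  let ?e = "enn2real (1 / q)"
  have space: "f \<in> fock_space \<alpha> p q" if "f holomorphic_on UNIV" "fock_norm \<alpha> p q f \<le> 1" for f p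
    using that by (auto simp: fock_space_def intro: le_less_trans)
  \<comment> \<open>For infinite \<open>q\<close> the exponent \<open>?e\<close> is 0 and the factor
    in \<open>1 + r\<close> is 1, so that case is treated separately.\<close>
  have e: "?e = 1 / enn2real q" if fin: "q \<noteq> \<infinity>"
  proof -
    obtain Q where "q = ennreal Q" "Q > 0"
      using \<open>q > 0\<close> fin by (cases q) auto
    moreover have "1 / ennreal Q = ennreal (1 / Q)"
      using divide_ennreal[of 1 Q] \<open>Q > 0\<close> by simp
    ultimately show ?thesis by simp
  qed
  \<comment> \<open>The constant is fixed before \<open>p\<close> and \<open>r\<close>; only the
    extremal function may depend on them.\<close>
  have "\<exists>c>0. \<forall>p r. p > 0 \<longrightarrow> r \<ge> 0 \<longrightarrow>
    (\<exists>f. f holomorphic_on UNIV \<and> fock_norm \<alpha> p q f \<le> 1 \<and>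
      integral_mean p f r = ennreal (c * ((1 + r) powr (- ?e) * exp (\<alpha> / 2 * r\<^sup>2))))"
  proof (cases "q = \<infinity>")
    case True
    have "\<exists>f. f holomorphic_on UNIV \<and> fock_norm \<alpha> p q f \<le> 1 \<and>
      integral_mean p f r = ennreal (exp (- 1) * ((1 + r) powr (- ?e) * exp (\<alpha> / 2 * r\<^sup>2)))"
      if pr: "p > 0" "r \<ge> 0" for p r
    proof -
      obtain f where "f holomorphic_on UNIV" "fock_norm \<alpha> p \<infinity> f \<le> 1"
        "integral_mean p f r = ennreal (exp (- 1) * exp (\<alpha> / 2 * r\<^sup>2))"
        using monomial_extremal_infinity[OF \<alpha> pr] by blast
      then show ?thesis
        using pr True by (intro exI[of _ f]) auto
    qed
    then show ?thesis
      by (intro exI[of _ "exp (- 1)"]) auto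
  next
    case False
    have Q: "\<alpha> * enn2real q > 0"
      using \<alpha> \<open>q > 0\<close> False by (simp add: enn2real_positive_iff less_top)
    define K where "K = \<alpha> * enn2real q * (sqrt (2 * pi / (\<alpha> * enn2real q)) * (2 + 1 / (\<alpha> * enn2real q)))"
    have "K > 0"
      using Q unfolding K_def by (intro mult_pos_pos[OF Q] mult_pos_pos[OF _ add_pos_pos]) auto
    moreover have "\<exists>f. f holomorphic_on UNIV \<and> fock_norm \<alpha> p q f \<le> 1 \<and>
      integral_mean p f r = ennreal (exp (- 1) * K powr (- (1 / enn2real q)) *
        ((1 + r) powr (- ?e) * exp (\<alpha> / 2 * r\<^sup>2)))" if "p > 0" "r \<ge> 0" for p r
      unfolding e[OF False]
      using monomial_extremal_finite[OF \<alpha> \<open>q > 0\<close> False that K_def] by blast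
    ultimately show ?thesis
      by (intro exI[of _ "exp (- 1) * K powr (- (1 / enn2real q))"]) auto
  qed
  then obtain c where c: "c > 0" "\<And>p r. p > 0 \<Longrightarrow> r \<ge> 0 \<Longrightarrow>
    \<exists>f. f holomorphic_on UNIV \<and> fock_norm \<alpha> p q f \<le> 1 \<and>
      integral_mean p f r = ennreal (c * ((1 + r) powr (- ?e) * exp (\<alpha> / 2 * r\<^sup>2)))"
    by blast
  have "\<exists>C>0. \<forall>p r f. p > 0 \<longrightarrow> r \<ge> 0 \<longrightarrow> f holomorphic_on UNIV \<longrightarrow> fock_norm \<alpha> p q f \<le> 1 \<longrightarrow>
      integral_mean p f r \<le> ennreal (C * ((1 + r) powr (- ?e) * exp (\<alpha> / 2 * r\<^sup>2)))"
  proof (cases "q = \<infinity>")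
    case True
    \<comment> \<open>For infinite \<open>q\<close> the norm is a supremum over all radii, so
      evaluating at \<open>r\<close> gives the bound with constant 1 and convexity does not
      enter.\<close>
    have "integral_mean p f r \<le> ennreal (1 * ((1 + r) powr (- ?e) * exp (\<alpha> / 2 * r\<^sup>2)))"
      if "r \<ge> 0" "fock_norm \<alpha> p q f \<le> 1" for p r f
    proof -
      let ?x = "\<alpha> / 2 * r\<^sup>2"
      have "integral_mean p f r * ennreal (exp (- (\<alpha> / 2) * r\<^sup>2)) \<le> fock_norm \<alpha> p q f"
        unfolding fock_norm_def using True that(1) by (simp, intro SUP_upper2[of r]) auto
      also have "\<dots> \<le> 1" by fact
      finally have "integral_mean p f r * ennreal (exp (- ?x)) * ennreal (exp ?x) \<le> 1 * ennreal (exp ?x)"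
        by (intro mult_right_mono) auto
      moreover have "ennreal (exp (- ?x)) * ennreal (exp ?x) = 1"
        by (simp add: exp_minus flip: ennreal_mult)
      ultimately show ?thesis
        using True that(1) by (simp add: mult.assoc)
    qed
    then show ?thesis
      by (intro exI[of _ 1]) auto
  next
    case False
    have "enn2real q > 0"
      using \<open>q > 0\<close> False by (simp add: enn2real_positive_iff less_top)
    then show ?thesis
      unfolding e[OF False] using integral_mean_le_growth[OF \<alpha> \<open>q > 0\<close> False] \<alpha>
      by (intro exI[of _ "(8 / (\<alpha> * enn2real q)) powr (1 / enn2real q) * exp (2 * \<alpha>)"]) auto
  qed
  then obtain C where C: "C > 0" "\<And>p r f. p > 0 \<Longrightarrow> r \<ge> 0 \<Longrightarrow>
      f holomorphic_on UNIV \<Longrightarrow> fock_norm \<alpha> p q f \<le> 1 \<Longrightarrow>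
      integral_mean p f r \<le> ennreal (C * ((1 + r) powr (- ?e) * exp (\<alpha> / 2 * r\<^sup>2)))"
    by blast
  show ?thesis
  proof (rule exI[of _ c], rule exI[of _ C], intro conjI allI impI c(1) C(1))
    fix p :: ennreal and r :: real
    assume pr: "p > 0" "r \<ge> 0"
    show "ennreal (c * ((1 + r) powr (- ?e) * exp (\<alpha> / 2 * r\<^sup>2)))
        \<le> (SUP f \<in> {f \<in> fock_space \<alpha> p q. fock_norm \<alpha> p q f \<le> 1}. integral_mean p f r)"
      using c(2)[OF pr] space by (metis (no_types, lifting) SUP_upper mem_Collect_eq)
    show "(SUP f \<in> {f \<in> fock_space \<alpha> p q. fock_norm \<alpha> p q f \<le> 1}. integral_mean p f r)
        \<le> ennreal (C * ((1 + r) powr (- ?e) * exp (\<alpha> / 2 * r\<^sup>2)))"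
      using C(2)[OF pr] by (auto simp: fock_space_def intro!: SUP_least)
  qed
qed

end
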